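(* Let $L\ge1$ and $M\ge3$ be integers, let $\lambda\in(0,L]$, and let $n$ be a positive integer with $n>\left(\frac{2L}{\lambda}\right)^2$. Then for each environment $\omega\in\Omega(L,M)$ with $T_{\lambda n}(\omega)\leq n$ there exists an environment $\omega'\in\Omega(L,M)$ with $T_{\lambda n}(\omega')\leq n$ such that $$\omega'\prec_{\lambda n,\,2L\sqrt n}\omega\quad\text{and}\quad X_{[0,T_{\lambda n}(\omega')]}(\omega')\cap(-\infty,-1]=\emptyset,$$ i.e. the walk in $\omega'$ visits no negative site up to time $T_{\lambda n}(\omega')$.
   Context: For integers $a\le b$ write $[a,b]=\{a,a+1,\dots,b\}$. For positive integers $L,M$ the set of environments is $$\Omega=\Omega(L,M)=\left\{\omega\in[-L,L]^{\mathbb{Z}_{\ge0}\times\mathbb{Z}}:\ \omega(j,z)=\omega(M-1,z)\text{ for all } j\ge M-1 \text{ and all } z\in\mathbb{Z}\right\}.$$ For $\omega\in\Omega$ the walk $X_t=X_t(\omega)$ is defined recursively by $X_0=0$ and $X_{t+1}=X_t+\omega(L_t(X_t),X_t)$, where $L_t(z)=L_t(\omega,z)=|\{0\le j<t: X_j=z\}|$. For real $x>0$, $T_x=T_x(\omega)=\inf\{n\ge0: X_n(\omega)\ge x\}$ (with $\inf\emptyset=\infty$). For $t_1\le t_2$, $X_{[t_1,t_2]}(\omega)=(X_{t_1}(\omega),X_{t_1+1}(\omega),\dots,X_{t_2}(\omega))$. For a sequence $a$ of integers and a set $B$, the restriction $a|_B$ is the sequence of those terms of $a$ that belong to $B$,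 with their order intact. For real numbers $0\le m<\ell$ and environments $\omega,\omega'\in\Omega$ with $T_\ell(\omega)<\infty$ and $T_\ell(\omega')<\infty$, the relation $\omega'\prec_{\ell,m}\omega$ means that the following three conditions hold: (1) $\omega'(j,x)=\omega(j,x)$ for all integers $x>m$ and all $j\ge0$; (2) $X_{[0,T_\ell(\omega')]}(\omega')\big|_{[m,\ell]}=X_{[0,T_\ell(\omega)]}(\omega)\big|_{[m,\ell]}$ (here $[m,\ell]$ is the real interval); (3) the sequence $X_{[0,T_\ell(\omega')]}(\omega')$ is a subsequence of $X_{[0,T_\ell(\omega)]}(\omega)$. *)

theory Defs
  imports Complex_Main "HOL-Library.Extended_Nat" "HOL-Library.Sublist"
begin

type_synonym env = "nat \<Rightarrow> int \<Rightarrow> int"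

definition environments :: "nat \<Rightarrow> nat \<Rightarrow> env set" where
  "environments L M = {\<omega>. (\<forall>j z. \<omega> j z \<in> {- int L..int L})
                        \<and> (\<forall>j\<ge>M - 1. \<forall>z. \<omega> j z = \<omega> (M - 1) z)}"

context notes conj_cong [fundef_cong] begin

fun walk :: "env \<Rightarrow> nat \<Rightarrow> int" where
  "walk \<omega> 0 = 0"
| "walk \<omega> (Suc t) = walk \<omega> t + \<omega> (card {j. j < t \<and> walk \<omega> j = walk \<omega> t}) (walk \<omega> t)"

end

(* The infimum in enat of the empty set is \<infinity>. *)
definition hit_time :: "env \<Rightarrow> real \<Rightarrow> enat" where
  "hit_time \<omega> x = Inf {enat n | n. real_of_int (walk \<omega> n) \<ge> x}"

(* The list X_0, ..., X_T with T = T_x, both endpoints included; only meaningful if T_x is finite. *)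
definition path_upto_hit :: "env \<Rightarrow> real \<Rightarrow> int list" where
  "path_upto_hit \<omega> x = map (walk \<omega>) [0..<Suc (the_enat (hit_time \<omega> x))]"

(* prec l m \<omega>' \<omega> stands for \<omega>' \<prec> \<omega> with index l,m. Finiteness of the hitting times is part of
   the relation, since it is only defined between environments whose walks reach level l.
   List.filter keeps the order of the terms, and subseq is the not necessarily contiguous
   subsequence relation. *)
definition prec :: "real \<Rightarrow> real \<Rightarrow> env \<Rightarrow> env \<Rightarrow> bool" where
  "prec l m \<omega>' \<omega> \<longleftrightarrow>
     hit_time \<omega>' l < \<infinity> \<and> hit_time \<omega> l < \<infinity> \<and>
     (\<forall>x::int. real_of_int x > m \<longrightarrow> (\<forall>j. \<omega>' j x = \<omega> j x)) \<and>
     filter (\<lambda>z. real_of_int z \<in> {m..l}) (path_upto_hit \<omega>' l)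
       = filter (\<lambda>z. real_of_int z \<in> {m..l}) (path_upto_hit \<omega> l) \<and>
     subseq (path_upto_hit \<omega>' l) (path_upto_hit \<omega> l)"

end

theory Submission
  imports Defs
begin

text \<open>
  Write \<open>\<ell> = \<lambda>n\<close> and \<open>m = 2L\<surd>n\<close>, so that \<open>m < \<ell>\<close>, and cut the nonnegative integers into blocks
  \<open>B\<^sub>k = [kL, (k+1)L)\<close>. Jumps have length at most \<open>L\<close>, so the walk cannot cross a block without
  visiting it, and any two sites of one block can be joined by a single jump.

  The walk makes at most \<open>n\<close> steps before reaching \<open>\<ell>\<close>, and about \<open>2\<surd>n\<close> blocks lie below \<open>m\<close>.
  If the \<open>k\<close>th of them were visited more than \<open>k\<close> times for every \<open>k\<close>, that would take more than
  \<open>n\<close> steps; so some \<open>B\<^sub>k\<close> is visited at most \<open>k\<close> times (\<open>rarely_visited_block\<close>). Put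
  \<open>h = kL\<close>. Every descent from \<open>[h, \<infinity>)\<close> to below \<open>h\<close> starts in \<open>B\<^sub>k\<close>, hence there are at most \<open>k\<close>
  of them.

  Among all environments preceding \<open>\<omega>\<close> take one with the smallest hitting time of \<open>\<ell>\<close>. The basic
  operation is to delete a piece of the path that stays below \<open>h\<close>, joining its two ends by a direct
  jump. This shifts the visit counts of the deleted sites, which is harmless because deleting terms
  from a sequence that is constant from index \<open>M - 1\<close> on leaves such a sequence. The direct
  jump itself is a new value, and it is allowed if the site it starts from has been visited fewer
  than \<open>M - 1\<close> times (or if the jump is the eventual one of that site). The result precedes \<open>\<omega>\<close>
  and has a smaller hitting time (\<open>shortcut_in_environments\<close>, \<open>prec_shortcut\<close>), so for the chosen
  environment no deletion is possible. This has two consequences. The walk never returns to the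
  same site while staying below \<open>h\<close>. And from a site of a block that has been visited
  fewer than \<open>M - 1\<close> times it cannot go below that block and come back without having reached \<open>h\<close>
  in between.

  The heart of the argument is \<open>irreducible_first_dip\<close>. Consider the descents from \<open>[h, \<infinity>)\<close>
  that reach \<open>B\<^sub>j\<close> or lower before returning to \<open>[h, \<infinity>)\<close>, and look at the earliest of them. The
  site at which it enters \<open>B\<^sub>j\<close> can have been visited before only in the initial part of the walk,
  which starts at \<open>0\<close> and ends with the first passage of \<open>h\<close>; and there at most once.
  As \<open>1 < M - 1\<close>, this descent does not go below \<open>B\<^sub>j\<close>. So each block stops at
  least one of the at most \<open>k\<close> descents, and none remains below the \<open>k\<close> blocks \<open>B\<^sub>0, ..., B\<^sub>k\<^sub>-\<^sub>1\<close>.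
  Nor does the initial part become negative, because it starts from a first visit in \<open>B\<^sub>0\<close>.
\<close>

section \<open>Visit counts\<close>

definition visits :: "env \<Rightarrow> nat \<Rightarrow> int \<Rightarrow> nat" where
  "visits \<omega> t z = card {j. j < t \<and> walk \<omega> j = z}"

lemma visits_0 [simp]: "visits \<omega> 0 z = 0"
  by (simp add: visits_def)

lemma visits_Suc: "visits \<omega> (Suc t) z = visits \<omega> t z + (if walk \<omega> t = z then 1 else 0)"
proof -
  have "{j. j < Suc t \<and> walk \<omega> j = z} =
        {j. j < t \<and> walk \<omega> j = z} \<union> (if walk \<omega> t = z then {t} else {})"
    by (auto simp: less_Suc_eq)
  then show ?thesis
    by (simp add: visits_def)
qed

lemma walk_Suc: "walk \<omega> (Suc t) = walk \<omega> t + \<omega> (visits \<omega> t (walk \<omega> t)) (walk \<omega> t)"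
  by (simp add: visits_def)

lemma visits_mono: "s \<le> t \<Longrightarrow> visits \<omega> s z \<le> visits \<omega> t z"
  by (induction t rule: dec_induct) (auto simp: visits_Suc)

lemma visits_less: "walk \<omega> s = z \<Longrightarrow> s < t \<Longrightarrow> visits \<omega> s z < visits \<omega> t z"
  using visits_mono[of "Suc s" t \<omega> z] by (simp add: visits_Suc)

lemma visits_const:
  assumes "s \<le> t" "\<And>u. s \<le> u \<Longrightarrow> u < t \<Longrightarrow> walk \<omega> u \<noteq> z"
  shows "visits \<omega> t z = visits \<omega> s z"
  using assms by (induction t rule: dec_induct) (auto simp: visits_Suc)

lemma visits_cong:
  assumes "\<And>u. u < t \<Longrightarrow> walk \<omega>' u = walk \<omega> u"
  shows "visits \<omega>' t z = visits \<omega> t z"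
  unfolding visits_def using assms by (metis (mono_tags, lifting))

lemma walk_step:
  assumes "\<omega> \<in> environments L M"
  shows "\<bar>walk \<omega> (Suc t) - walk \<omega> t\<bar> \<le> int L"
proof -
  have "\<omega> j z \<in> {- int L..int L}" for j z
    using assms by (auto simp: environments_def)
  then show ?thesis
    unfolding walk_Suc by (simp add: abs_le_iff minus_le_iff)
qed

lemma environments_stable:
  assumes "\<omega> \<in> environments L M" "M - 1 \<le> j"
  shows "\<omega> j z = \<omega> (M - 1) z"
  using assms unfolding environments_def by blast

section \<open>Cutting a piece out of the walk\<close>

text \<open>
  The walk in this environment follows the old one up to time \<open>s\<close>, jumps directly to the old position
  at time \<open>t\<close> and then continues as the old walk did. The index shift in the last case is the number
  of visits lost in the deleted piece.
\<close>

definition shortcut :: "env \<Rightarrow> nat \<Rightarrow> nat \<Rightarrow> env" where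
  "shortcut \<omega> s t = (\<lambda>j z.
     if j < visits \<omega> s z then \<omega> j z
     else if z = walk \<omega> s \<and> j = visits \<omega> s z then walk \<omega> t - walk \<omega> s
     else \<omega> (j + (visits \<omega> t z - visits \<omega> (Suc s) z)) z)"

lemma walk_shortcut_before: "u \<le> s \<Longrightarrow> walk (shortcut \<omega> s t) u = walk \<omega> u"
proof (induction u rule: less_induct)
  case (less u)
  show ?case
  proof (cases u)
    case (Suc v)
    have eq: "walk (shortcut \<omega> s t) v = walk \<omega> v"
      using less Suc by simp
    have vis: "visits (shortcut \<omega> s t) v z = visits \<omega> v z" for z
      by (rule visits_cong) (use less Suc in simp)
    have "visits \<omega> v (walk \<omega> v) < visits \<omega> s (walk \<omega> v)"
      using less.prems Suc by (intro visits_less) auto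
    then show ?thesis
      unfolding Suc walk_Suc eq vis by (simp add: shortcut_def)
  qed simp
qed

text \<open>
  The induction has to carry the visit counts along with the position: after the cut the two counts
  differ by exactly the shift that is built into \<^const>\<open>shortcut\<close>.
\<close>

lemma walk_shortcut_after:
  assumes "s < t"
  shows "walk (shortcut \<omega> s t) (Suc s + v) = walk \<omega> (t + v)"
proof -
  let ?w = "shortcut \<omega> s t"
  have "walk ?w (Suc s + v) = walk \<omega> (t + v) \<and>
        (\<forall>z. visits ?w (Suc s + v) z + visits \<omega> t z = visits \<omega> (t + v) z + visits \<omega> (Suc s) z)"
  proof (induction v)
    case 0
    have vis: "visits ?w s z = visits \<omega> s z" for z
      by (rule visits_cong) (simp add: walk_shortcut_before)
    have "walk ?w (Suc s) = walk \<omega> t"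
      unfolding walk_Suc vis walk_shortcut_before[OF order_refl] by (simp add: shortcut_def)
    then show ?case
      by (simp add: visits_Suc vis walk_shortcut_before)
  next
    case (Suc v)
    define z where "z = walk \<omega> (t + v)"
    have z: "walk ?w (Suc s + v) = z"
      using Suc z_def by simp
    have vis: "visits ?w (Suc s + v) z + visits \<omega> t z = visits \<omega> (t + v) z + visits \<omega> (Suc s) z"
      using Suc by blast
    have le1: "visits \<omega> (Suc s) z \<le> visits \<omega> t z" "visits \<omega> t z \<le> visits \<omega> (t + v) z"
      using assms by (auto intro: visits_mono)
    \<comment> \<open>The visit counter at \<^term>\<open>z\<close> has passed the index at which the jump was altered.\<close>
    have late: "visits \<omega> (Suc s) z \<le> visits ?w (Suc s + v) z"
      using vis le1 by linarith
    have "?w (visits ?w (Suc s + v) z) z = \<omega> (visits \<omega> (t + v) z) z"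
      using late vis le1 by (auto simp: shortcut_def visits_Suc split: if_splits)
    then have "walk ?w (Suc (Suc s + v)) = walk \<omega> (Suc (t + v))"
      unfolding walk_Suc z z_def[symmetric] by simp
    moreover have "visits ?w (Suc (Suc s + v)) y + visits \<omega> t y
        = visits \<omega> (Suc (t + v)) y + visits \<omega> (Suc s) y" for y
      using Suc unfolding visits_Suc[of ?w] visits_Suc[of \<omega> "t + v"] by simp
    ultimately show ?case by simp
  qed
  then show ?thesis by blast
qed

text \<open>
  The last clause keeps the altered environment eventually constant at the site of the new jump. Its
  second alternative covers the erasure of a loop at a site that has already used up its
  individual jumps: the new jump is then the one that follows the loop.
\<close>

definition removable :: "nat \<Rightarrow> nat \<Rightarrow> int \<Rightarrow> env \<Rightarrow> nat \<Rightarrow> nat \<Rightarrow> bool" where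
  "removable L M h \<omega> s t \<longleftrightarrow>
     Suc s < t \<and> (\<forall>u. s \<le> u \<and> u < t \<longrightarrow> walk \<omega> u < h) \<and>
     \<bar>walk \<omega> t - walk \<omega> s\<bar> \<le> int L \<and>
     (visits \<omega> s (walk \<omega> s) < M - 1 \<or> walk \<omega> t - walk \<omega> s = \<omega> (M - 1) (walk \<omega> s))"

lemma shortcut_in_environments:
  assumes env: "\<omega> \<in> environments L M" and rem: "removable L M h \<omega> s t"
  shows "shortcut \<omega> s t \<in> environments L M"
proof -
  have bounds: "- int L \<le> \<omega> j z" "\<omega> j z \<le> int L" for j z
    using env by (auto simp: environments_def)
  have jump: "- int L \<le> walk \<omega> t - walk \<omega> s" "walk \<omega> t - walk \<omega> s \<le> int L"
    using rem by (auto simp: removable_def abs_le_iff)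
  have late: "shortcut \<omega> s t j z = \<omega> (M - 1) z" if "M - 1 \<le> j" for j z
  proof -
    have "\<omega> (j + i) z = \<omega> (M - 1) z" for i
      using that by (intro environments_stable[OF env]) simp
    from this[of 0] this show ?thesis
      using that rem by (auto simp: shortcut_def removable_def simp del: One_nat_def)
  qed
  show ?thesis
    unfolding environments_def
  proof (intro CollectI conjI allI impI)
    show "shortcut \<omega> s t j z \<in> {- int L..int L}" for j z
      using bounds jump by (simp add: shortcut_def)
    show "shortcut \<omega> s t j z = shortcut \<omega> s t (M - 1) z" if "M - 1 \<le> j" for j z
      using late[OF that] late[of "M - 1"] by simp
  qed
qed

text \<open>
  The deleted piece and the start of the new jump lie below \<open>h\<close>, so no visit count at or
  above \<open>h\<close> is affected.
\<close>

lemma shortcut_unchanged_above: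
  assumes rem: "removable L M h \<omega> s t" and "h \<le> z"
  shows "shortcut \<omega> s t j z = \<omega> j z"
proof -
  have "walk \<omega> u \<noteq> z" if "Suc s \<le> u" "u < t" for u
  proof -
    have "walk \<omega> u < h"
      using rem that by (simp add: removable_def)
    then show ?thesis using \<open>h \<le> z\<close> by simp
  qed
  then have "visits \<omega> t z = visits \<omega> (Suc s) z"
    using rem by (intro visits_const) (auto simp: removable_def)
  moreover have "walk \<omega> s < h"
    using rem by (simp add: removable_def)
  ultimately show ?thesis
    using \<open>h \<le> z\<close> by (auto simp: shortcut_def)
qed

section \<open>Hitting times and the order on environments\<close>

definition first_hit :: "env \<Rightarrow> real \<Rightarrow> nat \<Rightarrow> bool" where
  "first_hit \<omega> x T \<longleftrightarrow> x \<le> real_of_int (walk \<omega> T) \<and> (\<forall>u<T. real_of_int (walk \<omega> u) < x)"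

lemma hit_time_eq:
  assumes "first_hit \<omega> x T"
  shows "hit_time \<omega> x = enat T"
  unfolding hit_time_def
proof (rule antisym)
  show "Inf {enat n |n. x \<le> real_of_int (walk \<omega> n)} \<le> enat T"
    using assms by (intro Inf_lower) (auto simp: first_hit_def)
  show "enat T \<le> Inf {enat n |n. x \<le> real_of_int (walk \<omega> n)}"
  proof (rule Inf_greatest)
    fix e assume "e \<in> {enat n |n. x \<le> real_of_int (walk \<omega> n)}"
    then obtain n where "e = enat n" "x \<le> real_of_int (walk \<omega> n)" by blast
    moreover then have "\<not> n < T"
      using assms by (force simp: first_hit_def)
    ultimately show "enat T \<le> e" by simp
  qed
qed

lemma first_hit_exists:
  assumes "hit_time \<omega> x < \<infinity>"
  obtains T where "first_hit \<omega> x T"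
proof -
  have "\<exists>T. x \<le> real_of_int (walk \<omega> T)"
  proof (rule ccontr)
    assume "\<nexists>T. x \<le> real_of_int (walk \<omega> T)"
    then have "hit_time \<omega> x = \<infinity>"
      by (simp add: hit_time_def top_enat_def)
    with assms show False by simp
  qed
  then obtain T where "x \<le> real_of_int (walk \<omega> T) \<and> (\<forall>u<T. \<not> x \<le> real_of_int (walk \<omega> u))"
    using exists_least_iff[of "\<lambda>T. x \<le> real_of_int (walk \<omega> T)"] by blast
  then show ?thesis
    by (intro that) (auto simp: first_hit_def)
qed

lemma path_upto_hit_eq:
  "first_hit \<omega> x T \<Longrightarrow> path_upto_hit \<omega> x = map (walk \<omega>) [0..<Suc T]"
  by (simp add: path_upto_hit_def hit_time_eq)

lemma prec_refl: "hit_time \<omega> l < \<infinity> \<Longrightarrow> prec l m \<omega> \<omega>"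
  by (simp add: prec_def)

lemma prec_trans: "prec l m \<omega>'' \<omega>' \<Longrightarrow> prec l m \<omega>' \<omega> \<Longrightarrow> prec l m \<omega>'' \<omega>"
  unfolding prec_def by (metis subseq_order.order_trans)

lemma shortcut_first_hit:
  assumes hit: "first_hit \<omega> x T" and "s < t" "t \<le> T"
  shows "first_hit (shortcut \<omega> s t) x (Suc s + (T - t))"
proof -
  have "walk (shortcut \<omega> s t) (Suc s + (T - t)) = walk \<omega> T"
    using walk_shortcut_after[of s t \<omega> "T - t"] assms by simp
  moreover have "real_of_int (walk (shortcut \<omega> s t) u) < x" if "u < Suc s + (T - t)" for u
  proof (cases "u \<le> s")
    case True
    then show ?thesis
      using assms by (simp add: walk_shortcut_before first_hit_def)
  next
    case False
    then obtain v where v: "u = Suc s + v"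
      by (metis less_eq_Suc_le not_le le_Suc_ex)
    then have "t + v < T" using that assms by linarith
    then show ?thesis
      using hit by (simp only: v walk_shortcut_after[OF \<open>s < t\<close>] first_hit_def)
  qed
  ultimately show ?thesis
    using hit by (simp add: first_hit_def)
qed

lemma path_shortcut:
  assumes hit: "first_hit \<omega> x T" and st: "s < t" "t \<le> T"
  shows "path_upto_hit (shortcut \<omega> s t) x = map (walk \<omega>) [0..<Suc s] @ map (walk \<omega>) [t..<Suc T]"
proof -
  let ?w = "shortcut \<omega> s t" and ?T = "Suc s + (T - t)"
  have "path_upto_hit ?w x = map (walk ?w) [0..<Suc ?T]"
    using shortcut_first_hit[OF assms] by (rule path_upto_hit_eq)
  also have "[0..<Suc ?T] = [0..<Suc s] @ [Suc s..<Suc s + (Suc T - t)]"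
    using st by (simp only: upt_add_eq_append[symmetric] Suc_diff_le) simp
  also have "map (walk ?w) \<dots> = map (walk ?w) [0..<Suc s] @ map (walk ?w) [Suc s..<Suc s + (Suc T - t)]"
    by simp
  also have "map (walk ?w) [0..<Suc s] = map (walk \<omega>) [0..<Suc s]"
    by (rule map_cong) (auto simp: walk_shortcut_before)
  also have "map (walk ?w) [Suc s..<Suc s + (Suc T - t)] = map (walk \<omega>) [t..<Suc T]"
  proof (rule nth_equalityI)
    fix i assume "i < length (map (walk ?w) [Suc s..<Suc s + (Suc T - t)])"
    then show "map (walk ?w) [Suc s..<Suc s + (Suc T - t)] ! i = map (walk \<omega>) [t..<Suc T] ! i"
      using st walk_shortcut_after[of s t \<omega> i] by (simp del: upt_Suc)
  qed (use st in simp)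
  finally show ?thesis .
qed

lemma prec_shortcut:
  assumes hit: "first_hit \<omega> l T" and rem: "removable L M h \<omega> s t" and "t \<le> T"
    and "real_of_int h \<le> m"
  shows "prec l m (shortcut \<omega> s t) \<omega>"
proof -
  have st: "s < t" "Suc s \<le> t" and below: "\<And>u. s \<le> u \<Longrightarrow> u < t \<Longrightarrow> walk \<omega> u < h"
    using rem by (auto simp: removable_def)
  have "[0..<Suc T] = [0..<Suc s] @ [Suc s..<t] @ [t..<Suc T]"
    using st \<open>t \<le> T\<close>
    by (metis append_assoc le_SucI le_add_diff_inverse upt_add_eq_append zero_le)
  then have path: "path_upto_hit \<omega> l =
      map (walk \<omega>) [0..<Suc s] @ map (walk \<omega>) [Suc s..<t] @ map (walk \<omega>) [t..<Suc T]"
    unfolding path_upto_hit_eq[OF hit] by (metis map_append)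
  note path' = path_shortcut[OF hit \<open>s < t\<close> \<open>t \<le> T\<close>]
  have "real_of_int (walk \<omega> u) < m" if "Suc s \<le> u" "u < t" for u
  proof -
    have "real_of_int (walk \<omega> u) < real_of_int h"
      using below that by simp
    then show ?thesis using \<open>real_of_int h \<le> m\<close> by linarith
  qed
  then have "filter (\<lambda>z. real_of_int z \<in> {m..l}) (map (walk \<omega>) [Suc s..<t]) = []"
    by (force simp: filter_empty_conv)
  then have "filter (\<lambda>z. real_of_int z \<in> {m..l}) (path_upto_hit (shortcut \<omega> s t) l)
      = filter (\<lambda>z. real_of_int z \<in> {m..l}) (path_upto_hit \<omega> l)"
    unfolding path path' filter_append by simp
  moreover have "subseq (path_upto_hit (shortcut \<omega> s t) l) (path_upto_hit \<omega> l)"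
    unfolding path path' by (intro list_emb_append_mono list_emb_append2 subseq_order.order_refl)
  moreover have "shortcut \<omega> s t j z = \<omega> j z" if "m < real_of_int z" for j z
    using that \<open>real_of_int h \<le> m\<close> by (intro shortcut_unchanged_above[OF rem]) linarith
  ultimately show ?thesis
    using hit_time_eq[OF hit] hit_time_eq[OF shortcut_first_hit[OF hit \<open>s < t\<close> \<open>t \<le> T\<close>]]
    by (simp add: prec_def)
qed

section \<open>Walks from which nothing can be removed\<close>

text \<open>
  An environment of minimal hitting time has this property; it is all that is used of minimality.
\<close>

definition irreducible :: "nat \<Rightarrow> nat \<Rightarrow> int \<Rightarrow> env \<Rightarrow> nat \<Rightarrow> bool" where
  "irreducible L M h \<omega> T \<longleftrightarrow> (\<forall>s t. t \<le> T \<longrightarrow> \<not> removable L M h \<omega> s t)"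

lemma first_return:
  assumes env: "\<omega> \<in> environments L M" and "v < T" "walk \<omega> v < c" "c \<le> walk \<omega> T"
  obtains t where "v < t" "t \<le> T" "c \<le> walk \<omega> t" "walk \<omega> t < c + int L"
    "\<And>u. v \<le> u \<Longrightarrow> u < t \<Longrightarrow> walk \<omega> u < c"
proof -
  obtain t where t: "v < t \<and> c \<le> walk \<omega> t" "\<forall>u<t. \<not> (v < u \<and> c \<le> walk \<omega> u)"
    using exists_least_iff[of "\<lambda>t. v < t \<and> c \<le> walk \<omega> t"] assms by blast
  have below: "walk \<omega> u < c" if "v \<le> u" "u < t" for u
    using t(2) that \<open>walk \<omega> v < c\<close> by (cases "u = v") force+
  obtain r where r: "t = Suc r" using t(1) by (cases t) auto
  have "walk \<omega> t < c + int L"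
    using below[of r] walk_step[OF env, of r] t(1) r by (auto simp: abs_le_iff)
  moreover have "t \<le> T"
    using t(2) assms not_le by blast
  ultimately show ?thesis using that t(1) below by blast
qed

lemma last_exceedance:
  fixes f :: "nat \<Rightarrow> int"
  assumes "s < v" "h \<le> f s"
  obtains r where "s \<le> r" "r < v" "h \<le> f r" "\<And>u. r < u \<Longrightarrow> u < v \<Longrightarrow> f u < h"
proof -
  let ?S = "{r. r < v \<and> h \<le> f r}"
  have fin: "finite ?S" and mem: "s \<in> ?S" using assms by auto
  have "Max ?S \<in> ?S" using fin mem by (intro Max_in) auto
  moreover have "s \<le> Max ?S" using fin mem by simp
  moreover have "f u < h" if "Max ?S < u" "u < v" for u
    using that fin Max_ge[OF fin, of u] by (force simp: not_le[symmetric])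
  ultimately show ?thesis using that by blast
qed

text \<open>
  A loop can be erased by jumping at its first visit straight to the successor of its last
  visit. This is always allowed: if the first visit has index at least \<open>M - 1\<close>, so has the last, and the
  jump out of the loop is the eventual one.
\<close>

lemma irreducible_no_repeat:
  assumes env: "\<omega> \<in> environments L M"
    and irr: "irreducible L M h \<omega> T"
    and "v < v'" "v' < T" "walk \<omega> v = walk \<omega> v'"
    and below: "\<And>u. v \<le> u \<Longrightarrow> u \<le> v' \<Longrightarrow> walk \<omega> u < h"
  shows False
proof -
  let ?z = "walk \<omega> v"
  have jump: "walk \<omega> (Suc v') - ?z = \<omega> (visits \<omega> v' ?z) ?z"
    by (simp only: walk_Suc \<open>walk \<omega> v = walk \<omega> v'\<close>)
  have "\<bar>walk \<omega> (Suc v') - ?z\<bar> \<le> int L"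
    using walk_step[OF env, of v'] assms by simp
  moreover have "walk \<omega> (Suc v') - ?z = \<omega> (M - 1) ?z" if "\<not> visits \<omega> v ?z < M - 1"
  proof -
    have "M - 1 \<le> visits \<omega> v' ?z"
      using that visits_mono[of v v' \<omega> ?z] \<open>v < v'\<close> by linarith
    then show ?thesis
      unfolding jump by (rule environments_stable[OF env])
  qed
  ultimately have "removable L M h \<omega> v (Suc v')"
    using \<open>v < v'\<close> below unfolding removable_def by auto
  then show False
    using irr \<open>v' < T\<close> by (auto simp: irreducible_def)
qed

text \<open>
  Before reaching its final level the walk has to come back up to \<open>c\<close>, and its first return lands
  within \<open>L\<close> above \<open>c\<close>, that is in the block where it was at time \<open>u\<close>. The two ends are thus close
  enough for a direct jump, which the small visit count permits.
\<close>

lemma irreducible_no_dip: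
  assumes env: "\<omega> \<in> environments L M"
    and irr: "irreducible L M h \<omega> T"
    and young: "visits \<omega> u (walk \<omega> u) < M - 1"
    and "c \<le> walk \<omega> u" "walk \<omega> u < c + int L" "c \<le> h"
    and "u < v" "v < T" "walk \<omega> v < c" "c \<le> walk \<omega> T"
    and below: "\<And>r. u \<le> r \<Longrightarrow> r \<le> v \<Longrightarrow> walk \<omega> r < h"
  shows False
proof -
  obtain t where t: "v < t" "t \<le> T" "c \<le> walk \<omega> t" "walk \<omega> t < c + int L"
      "\<And>r. v \<le> r \<Longrightarrow> r < t \<Longrightarrow> walk \<omega> r < c"
    using first_return[OF env] assms by blast
  have "walk \<omega> r < h" if "u \<le> r" "r < t" for r
    using below[of r] t(5)[of r] that \<open>c \<le> h\<close> by (cases "r \<le> v") auto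
  then have "removable L M h \<omega> u t"
    using t assms by (auto simp: removable_def)
  then show False using irr t by (auto simp: irreducible_def)
qed

text \<open>
  A descent from \<open>[h, \<infinity>)\<close> is identified by the time of the last position before it; only descents
  that reach \<open>(-\<infinity>, c)\<close> before coming back to \<open>[h, \<infinity>)\<close> are collected.
\<close>

definition dips :: "env \<Rightarrow> nat \<Rightarrow> int \<Rightarrow> int \<Rightarrow> nat set" where
  "dips \<omega> T h c = {s. s < T \<and> h \<le> walk \<omega> s \<and>
     (\<exists>u. s < u \<and> u < T \<and> walk \<omega> u < c \<and> (\<forall>v. s < v \<and> v \<le> u \<longrightarrow> walk \<omega> v < h))}"

lemma finite_dips [simp]: "finite (dips \<omega> T h c)"
  by (rule finite_subset[of _ "{..<T}"]) (auto simp: dips_def)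

text \<open>
  The reason is that the earliest descent below \<open>c + L\<close> enters the block \<open>[c, c + L)\<close> at a site with at
  most one earlier visit. Indeed, an earlier visit after the walk has first reached \<open>h\<close> would belong to an
  earlier descent of the same kind or precede the entrance within this one; and two visits before
  the walk reaches \<open>h\<close> would form an erasable loop. With \<open>M \<ge> 3\<close> the site therefore still has a free jump, and
  \<open>irreducible_no_dip\<close> applies.
\<close>

lemma irreducible_first_dip:
  assumes env: "\<omega> \<in> environments L M" and "3 \<le> M"
    and irr: "irreducible L M h \<omega> T"
    and "c + int L \<le> h" "h \<le> walk \<omega> T"
    and nonempty: "dips \<omega> T h (c + int L) \<noteq> {}"
  shows "Min (dips \<omega> T h (c + int L)) \<notin> dips \<omega> T h c"
proof
  let ?D = "dips \<omega> T h (c + int L)"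
  define s where "s = Min ?D"
  have s_in: "s \<in> ?D" and s_min: "\<And>r. r \<in> ?D \<Longrightarrow> s \<le> r"
    using nonempty by (auto simp: s_def)
  assume "Min ?D \<in> dips \<omega> T h c"
  then obtain v where v: "s < v" "v < T" "walk \<omega> v < c"
      "\<And>r. s < r \<Longrightarrow> r \<le> v \<Longrightarrow> walk \<omega> r < h"
    unfolding s_def[symmetric] by (auto simp: dips_def)
  have "h \<le> walk \<omega> s" using s_in by (simp add: dips_def)
  \<comment> \<open>The entrance into the block: no jump of length at most \<open>L\<close> can skip \<open>[c, c + L)\<close>.\<close>
  obtain u where u: "s < u \<and> walk \<omega> u < c + int L"
      "\<forall>r<u. \<not> (s < r \<and> walk \<omega> r < c + int L)"
    using exists_least_iff[of "\<lambda>r. s < r \<and> walk \<omega> r < c + int L"] v by force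
  have "u \<le> v" using u(2) v by (intro leI notI) force
  obtain r where r: "u = Suc r" using u(1) by (cases u) auto
  have "c + int L \<le> walk \<omega> r"
    using u r \<open>h \<le> walk \<omega> s\<close> \<open>c + int L \<le> h\<close> by (cases "r = s") force+
  then have "c \<le> walk \<omega> u"
    using walk_step[OF env, of r] r by (auto simp: abs_le_iff)
  then have "u \<noteq> v" using v by auto
  then have "u < v" using \<open>u \<le> v\<close> by simp
  define z where "z = walk \<omega> u"
  \<comment> \<open>Earlier visits to the entrance site happen before the walk first reaches \<open>h\<close>.\<close>
  have initial: "walk \<omega> p < h" if "w < u" "walk \<omega> w = z" "p \<le> w" for p w
  proof (rule ccontr)
    assume "\<not> walk \<omega> p < h"
    moreover have "walk \<omega> w < h"
      using that u(1) \<open>c + int L \<le> h\<close> by (simp add: z_def)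
    ultimately have "p < w" "h \<le> walk \<omega> p"
      using that by (cases "p = w"; force)+
    then obtain q where q: "q < w" "h \<le> walk \<omega> q" "\<And>x. q < x \<Longrightarrow> x < w \<Longrightarrow> walk \<omega> x < h"
      by (metis last_exceedance)
    have "q \<in> ?D"
      using q that u(1) \<open>walk \<omega> w < h\<close> \<open>u < v\<close> \<open>v < T\<close>
      by (auto simp: dips_def z_def nat_less_le intro!: exI[of _ w])
        (metis nat_less_le)
    then have "s \<le> q" by (rule s_min)
    then have "s < w" using q by simp
    then show False using u that by (auto simp: z_def)
  qed
  have "card {w. w < u \<and> walk \<omega> w = z} \<le> Suc 0"
  proof (subst card_le_Suc0_iff_eq)
    have "w = w'" if w: "w < u" "walk \<omega> w = z" "w' < u" "walk \<omega> w' = z" for w w'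
    proof (rule ccontr)
      assume "w \<noteq> w'"
      then show False
        using irreducible_no_repeat[OF env irr, of w w'] irreducible_no_repeat[OF env irr, of w' w]
          initial w \<open>u < v\<close> \<open>v < T\<close> by (metis less_trans linorder_neqE_nat)
    qed
    then show "\<forall>w\<in>{w. w < u \<and> walk \<omega> w = z}. \<forall>w'\<in>{w. w < u \<and> walk \<omega> w = z}. w = w'"
      by blast
  qed simp
  then have young: "visits \<omega> u (walk \<omega> u) < M - 1"
    using \<open>3 \<le> M\<close> by (simp add: visits_def z_def)
  show False
    by (rule irreducible_no_dip[OF env irr young \<open>c \<le> walk \<omega> u\<close> _ _ \<open>u < v\<close> \<open>v < T\<close> v(3)])
      (use u(1) v(4) assms in auto)
qed

text \<open>
  Going down from block to block, each one loses at least the first of the descents that reach it.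
\<close>

lemma irreducible_card_dips:
  assumes env: "\<omega> \<in> environments L M" and "3 \<le> M"
    and irr: "irreducible L M (int k * int L) \<omega> T"
    and top: "int k * int L \<le> walk \<omega> T"
    and few: "card (dips \<omega> T (int k * int L) (int k * int L)) \<le> k"
    and "j \<le> k"
  shows "card (dips \<omega> T (int k * int L) (int j * int L)) \<le> j"
  using \<open>j \<le> k\<close>
proof (induction j rule: inc_induct)
  case base
  show ?case by (rule few)
next
  case (step j)
  let ?A = "dips \<omega> T (int k * int L) (int j * int L)"
  let ?B = "dips \<omega> T (int k * int L) (int j * int L + int L)"
  have B: "card ?B \<le> Suc j" using step.IH by (simp add: algebra_simps)
  have "int (Suc j) * int L \<le> int k * int L"
    using step.hyps by (intro mult_right_mono) auto
  then have le: "int j * int L + int L \<le> int k * int L" by (simp add: algebra_simps)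
  have sub: "?A \<subseteq> ?B" by (force simp: dips_def)
  show ?case
  proof (cases "?B = {}")
    case True
    then show ?thesis using sub by simp
  next
    case False
    then have "Min ?B \<in> ?B - ?A"
      using irreducible_first_dip[OF env \<open>3 \<le> M\<close> irr le top False] by simp
    then have "?A \<subset> ?B" using sub by blast
    then have "card ?A < card ?B" by (intro psubset_card_mono) simp
    then show ?thesis using B by simp
  qed
qed

text \<open>
  A visit to a negative site either belongs to a descent that starts at or above \<open>h\<close>, and these are
  excluded by counting, or to the initial part of the walk; there the cut would start at
  time \<open>0\<close>, with visit count \<open>0\<close>.
\<close>

lemma irreducible_nonneg:
  assumes env: "\<omega> \<in> environments L M" and "3 \<le> M" and "1 \<le> L" and "1 \<le> k"
    and irr: "irreducible L M (int k * int L) \<omega> T"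
    and top: "int k * int L \<le> walk \<omega> T"
    and few: "card {u. u < T \<and> int k * int L \<le> walk \<omega> u \<and> walk \<omega> u < int (Suc k) * int L} \<le> k"
    and "v \<le> T"
  shows "0 \<le> walk \<omega> v"
proof (rule ccontr)
  let ?h = "int k * int L"
  assume "\<not> 0 \<le> walk \<omega> v"
  then have neg: "walk \<omega> v < 0" by simp
  have hpos: "0 < ?h" using \<open>1 \<le> L\<close> \<open>1 \<le> k\<close> by simp
  then have "v \<noteq> T" using neg top by auto
  then have "v < T" using \<open>v \<le> T\<close> by simp
  have "0 < v" using neg by (cases v) auto
  have dips_k: "dips \<omega> T ?h ?h \<subseteq> {u. u < T \<and> ?h \<le> walk \<omega> u \<and> walk \<omega> u < int (Suc k) * int L}"
  proof
    fix s assume s: "s \<in> dips \<omega> T ?h ?h"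
    then have "walk \<omega> (Suc s) < ?h" by (auto simp: dips_def)
    then have "walk \<omega> s < int (Suc k) * int L"
      using walk_step[OF env, of s] by (auto simp: abs_le_iff algebra_simps)
    then show "s \<in> {u. u < T \<and> ?h \<le> walk \<omega> u \<and> walk \<omega> u < int (Suc k) * int L}"
      using s by (simp add: dips_def)
  qed
  then have "card (dips \<omega> T ?h ?h) \<le> k"
    using few by (intro order_trans[OF card_mono[OF _ dips_k]]) auto
  then have "card (dips \<omega> T ?h (int 0 * int L)) \<le> 0"
    by (rule irreducible_card_dips[OF env \<open>3 \<le> M\<close> irr top]) simp
  then have no_dip: "dips \<omega> T ?h 0 = {}" by simp
  show False
  proof (cases "\<exists>s<v. ?h \<le> walk \<omega> s")
    case True
    then obtain r where r: "r < v" "?h \<le> walk \<omega> r" "\<And>u. r < u \<Longrightarrow> u < v \<Longrightarrow> walk \<omega> u < ?h"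
      by (metis last_exceedance)
    have "walk \<omega> u < ?h" if "r < u" "u \<le> v" for u
      using r(3)[of u] that neg hpos by (cases "u = v") auto
    then have "r \<in> dips \<omega> T ?h 0"
      using r neg \<open>v < T\<close> by (auto simp: dips_def)
    then show False using no_dip by simp
  next
    case False
    have "walk \<omega> u < ?h" if "u \<le> v" for u
    proof (cases "u = v")
      case True
      then show ?thesis using neg hpos by simp
    next
      case differs: False
      then have "u < v" using that by simp
      then show ?thesis using False by (meson not_le)
    qed
    then show False
      using irreducible_no_dip[OF env irr, of 0 0 v] \<open>3 \<le> M\<close> \<open>0 < v\<close> \<open>v < T\<close> neg top hpos \<open>1 \<le> L\<close>
      by auto
  qed
qed

section \<open>A rarely visited block\<close>

lemma sum_Suc_gauss: "2 * (\<Sum>k<K. Suc k) = K * Suc K"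
  by (induction K) auto

text \<open>
  Otherwise the \<open>K\<close> disjoint blocks would account for \<open>1 + ... + K\<close> times, and
  \<open>K (K + 1) / 2 > (2q - 1) 2q / 2 = 2q\<^sup>2 - q \<ge> n\<close> for \<open>q = \<surd>n\<close>,
  as \<open>K > 2q - 1\<close>.
\<close>

lemma rarely_visited_block:
  fixes f :: "nat \<Rightarrow> int"
  assumes "T \<le> n" "0 < n" "K = nat \<lfloor>2 * sqrt (real n)\<rfloor>"
  obtains k where "k < K"
    "card {u. u < T \<and> int k * int L \<le> f u \<and> f u < int (Suc k) * int L} \<le> k"
proof -
  define V where "V k = {u. u < T \<and> int k * int L \<le> f u \<and> f u < int (Suc k) * int L}" for k
  have "\<exists>k<K. card (V k) \<le> k"
  proof (rule ccontr)
    assume "\<not> (\<exists>k<K. card (V k) \<le> k)"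
    then have "(\<Sum>k<K. Suc k) \<le> (\<Sum>k<K. card (V k))"
      by (intro sum_mono) (auto simp: not_le Suc_le_eq)
    also have "\<dots> = card (\<Union>k<K. V k)"
    proof (rule card_UN_disjoint[symmetric])
      have "V i \<inter> V j = {}" if "i < j" for i j
      proof -
        have "int (Suc i) * int L \<le> int j * int L"
          using that by (intro mult_right_mono) auto
        then show ?thesis by (auto simp: V_def)
      qed
      then show "\<forall>i\<in>{..<K}. \<forall>j\<in>{..<K}. i \<noteq> j \<longrightarrow> V i \<inter> V j = {}"
        by (metis inf_commute linorder_neqE_nat)
    qed (auto simp: V_def)
    also have "\<dots> \<le> card {..<T}"
      by (intro card_mono) (auto simp: V_def)
    finally have "K * Suc K \<le> 2 * n"
      using sum_Suc_gauss[of K] \<open>T \<le> n\<close> by simp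
    then have upper: "real K * (real K + 1) \<le> 2 * real n"
      by (metis of_nat_Suc of_nat_le_iff of_nat_mult of_nat_numeral add.commute)
    define q where "q = sqrt (real n)"
    have q: "1 \<le> q" "q * q = real n"
      using \<open>0 < n\<close> by (auto simp: q_def)
    have K: "2 * q < real K + 1" "2 * q - 1 \<le> real K"
      using assms(3) q by (simp_all add: q_def[symmetric])
    have "(2 * q - 1) * (2 * q) < real K * (real K + 1)"
      using K q by (intro mult_le_less_imp_less) auto
    moreover have "q * 1 \<le> q * q"
      using q by (intro mult_left_mono) auto
    ultimately show False
      using upper q by (simp add: algebra_simps)
  qed
  then show ?thesis
    using that unfolding V_def by blast
qed

lemma length_filter_path:
  assumes "first_hit \<omega> x T" "\<not> P (walk \<omega> T)"
  shows "length (filter P (path_upto_hit \<omega> x)) = card {u. u < T \<and> P (walk \<omega> u)}"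
proof -
  have "length (filter P (path_upto_hit \<omega> x)) = length (filter (P \<circ> walk \<omega>) [0..<T])"
    using assms by (simp add: path_upto_hit_eq filter_map)
  also have "\<dots> = card (set (filter (P \<circ> walk \<omega>) [0..<T]))"
    by (rule distinct_card[symmetric]) simp
  also have "set (filter (P \<circ> walk \<omega>) [0..<T]) = {u. u < T \<and> P (walk \<omega> u)}"
    by auto
  finally show ?thesis .
qed

theorem lemma4:
  fixes L M n :: nat and lam :: real and \<omega> :: env
  assumes "L \<ge> 1" and "M \<ge> 3"
    and "0 < lam" and "lam \<le> real L"
    and "n > 0" and "real n > (2 * real L / lam)\<^sup>2"
    and "\<omega> \<in> environments L M"
    and "hit_time \<omega> (lam * real n) \<le> enat n"
  shows "\<exists>\<omega>' \<in> environments L M.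
           hit_time \<omega>' (lam * real n) \<le> enat n \<and>
           prec (lam * real n) (2 * real L * sqrt (real n)) \<omega>' \<omega> \<and>
           set (path_upto_hit \<omega>' (lam * real n)) \<inter> {..-1} = {}"
proof -
  define l where "l = lam * real n"
  define m where "m = 2 * real L * sqrt (real n)"
  have "2 * real L / lam < sqrt (real n)"
    using assms(6) by (rule real_less_rsqrt)
  then have "2 * real L < lam * sqrt (real n)"
    using \<open>0 < lam\<close> by (simp add: field_simps)
  then have "2 * real L * sqrt (real n) < lam * sqrt (real n) * sqrt (real n)"
    using \<open>n > 0\<close> by (intro mult_strict_right_mono) auto
  then have ml: "m < l"
    by (simp add: m_def l_def mult.assoc)
  have fin: "hit_time \<omega> l < \<infinity>"
    using assms(8) unfolding l_def[symmetric] by (cases "hit_time \<omega> l") auto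
  then obtain T where T: "first_hit \<omega> l T" by (rule first_hit_exists)
  have "T \<le> n"
    using assms(8) hit_time_eq[OF T] by (simp add: l_def)
  define K where "K = nat \<lfloor>2 * sqrt (real n)\<rfloor>"
  obtain k where k: "k < K"
      "card {u. u < T \<and> int k * int L \<le> walk \<omega> u \<and> walk \<omega> u < int (Suc k) * int L} \<le> k"
    using rarely_visited_block[OF \<open>T \<le> n\<close> \<open>n > 0\<close> K_def] .
  have "real K \<le> 2 * sqrt (real n)"
    by (simp add: K_def)
  then have "real (Suc k) \<le> 2 * sqrt (real n)"
    using k(1) by linarith
  then have "real (Suc k) * real L \<le> 2 * sqrt (real n) * real L"
    by (rule mult_right_mono) simp
  then have Suc_k_m: "real_of_int (int (Suc k) * int L) \<le> m"
    by (simp add: m_def algebra_simps)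
  have "real k * real L \<le> real (Suc k) * real L"
    by (rule mult_right_mono) auto
  then have k_m: "real_of_int (int k * int L) \<le> m"
    using Suc_k_m by simp
  have "0 \<le> m" by (simp add: m_def)

  \<comment> \<open>An environment of minimal hitting time among those preceding \<^term>\<open>\<omega>\<close>.\<close>
  let ?C = "\<lambda>\<omega>' T'. \<omega>' \<in> environments L M \<and> prec l m \<omega>' \<omega> \<and> first_hit \<omega>' l T'"
  have "\<exists>T' \<omega>'. ?C \<omega>' T'"
    using assms(7) prec_refl[OF fin] T by blast
  then obtain T' where T': "\<exists>\<omega>'. ?C \<omega>' T'" and least: "\<forall>t<T'. \<not> (\<exists>\<omega>'. ?C \<omega>' t)"
    using exists_least_iff[of "\<lambda>T'. \<exists>\<omega>'. ?C \<omega>' T'"] by blast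
  then obtain \<omega>' where env: "\<omega>' \<in> environments L M" and prec: "prec l m \<omega>' \<omega>"
      and hit: "first_hit \<omega>' l T'"
    by blast
  have irr: "irreducible L M (int k * int L) \<omega>' T'"
    unfolding irreducible_def
  proof (intro allI impI notI)
    fix s t assume that: "t \<le> T'" and rem: "removable L M (int k * int L) \<omega>' s t"
    then have "s < t" "Suc s + (T' - t) < T'"
      using that by (auto simp: removable_def)
    moreover have "?C (shortcut \<omega>' s t) (Suc s + (T' - t))"
      using shortcut_in_environments[OF env rem] shortcut_first_hit[OF hit \<open>s < t\<close> that]
        prec_trans[OF prec_shortcut[OF hit rem that k_m] prec] by blast
    ultimately show False using least by blast
  qed

  have sub: "subseq (path_upto_hit \<omega>' l) (path_upto_hit \<omega> l)"
    using prec by (simp add: prec_def)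
  \<comment> \<open>The final position lies above the block, so it does not disturb the comparison of visits.\<close>
  have end_high: "\<not> walk \<omega>'' S < int (Suc k) * int L" if "first_hit \<omega>'' l S" for \<omega>'' S
  proof
    assume "walk \<omega>'' S < int (Suc k) * int L"
    then have "real_of_int (walk \<omega>'' S) < real_of_int (int (Suc k) * int L)"
      by (simp only: of_int_less_iff)
    then show False using that Suc_k_m ml unfolding first_hit_def by linarith
  qed
  let ?P = "\<lambda>z. int k * int L \<le> z \<and> z < int (Suc k) * int L"
  have "card {u. u < T' \<and> ?P (walk \<omega>' u)} = length (filter ?P (path_upto_hit \<omega>' l))"
    using end_high[OF hit] by (intro length_filter_path[OF hit, symmetric]) blast
  also have "\<dots> \<le> length (filter ?P (path_upto_hit \<omega> l))"
    by (rule list_emb_length[OF subseq_filter[OF sub]])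
  also have "\<dots> = card {u. u < T \<and> ?P (walk \<omega> u)}"
    using end_high[OF T] by (intro length_filter_path[OF T]) blast
  finally have few: "card {u. u < T' \<and> ?P (walk \<omega>' u)} \<le> k"
    using k(2) by linarith
  \<comment> \<open>The walk starts in the block \<open>[0, L)\<close>, so that one is visited.\<close>
  have "k \<noteq> 0"
  proof
    assume "k = 0"
    have "T \<noteq> 0"
    proof
      assume "T = 0"
      then show False using T ml \<open>0 \<le> m\<close> by (simp add: first_hit_def)
    qed
    then have "0 \<in> {u. u < T \<and> ?P (walk \<omega> u)}"
      unfolding mem_Collect_eq walk.simps(1) using \<open>k = 0\<close> \<open>L \<ge> 1\<close> by simp
    moreover have "finite {u. u < T \<and> ?P (walk \<omega> u)}" by simp
    ultimately have "card {u. u < T \<and> ?P (walk \<omega> u)} \<noteq> 0"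
      by (metis card_0_eq empty_iff)
    then show False using k(2) \<open>k = 0\<close> by linarith
  qed
  have "int k * int L \<le> walk \<omega>' T'"
    using end_high[OF hit] by (simp add: algebra_simps)
  then have nonneg: "0 \<le> walk \<omega>' v" if "v \<le> T'" for v
    using irreducible_nonneg[OF env \<open>M \<ge> 3\<close> \<open>L \<ge> 1\<close> _ irr _ few that] \<open>k \<noteq> 0\<close> by simp
  have "0 \<le> z" if "z \<in> set (path_upto_hit \<omega>' l)" for z
    using nonneg that by (auto simp: path_upto_hit_eq[OF hit] less_Suc_eq_le simp del: upt_Suc)
  then have "set (path_upto_hit \<omega>' l) \<inter> {..-1} = {}"
    by force
  moreover have "T' \<le> T"
    using list_emb_length[OF sub] by (simp add: path_upto_hit_eq[OF hit] path_upto_hit_eq[OF T])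
  then have "hit_time \<omega>' l \<le> enat n"
    using \<open>T \<le> n\<close> hit_time_eq[OF hit] by simp
  ultimately show ?thesis
    using env prec unfolding l_def m_def by blast
qed

end
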